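(* Let $n\geq 2$ and $A\in\mathcal{PC}_n$. Then, for any $i\in\{1,\ldots,n\}$, $\mathcal{E}(A;i)$ is PWL connected.
   Context: $\mathcal{PC}_n$ is the set of $n$-by-$n$ reciprocal matrices: entrywise positive real matrices $A=[a_{ij}]$ with $a_{ji}=1/a_{ij}$ for all $1\leq i,j\leq n$. $\mathcal{V}_n$ is the set of entrywise positive real $n$-vectors. A vector $w\in\mathcal{V}_n$ is efficient for $A\in\mathcal{PC}_n$ if for every $v\in\mathcal{V}_n$, the entrywise inequalities $\left|a_{ij}-\frac{v_i}{v_j}\right|\leq\left|a_{ij}-\frac{w_i}{w_j}\right|$ for all $i,j$ imply that $v$ is proportional to $w$. $\mathcal{E}(A)$ is the set of all efficient vectors for $A$. $A(i)$ is the principal submatrix of $A$ obtained by deleting row and column $i$, and $w(i)$ is the vector obtained from $w$ by deleting its $i$th entry. (If $A$ is reciprocal, so is $A(i)$.) $\mathcal{E}(A;i)$ is the set of $w\in\mathcal{E}(A)$ such that $w(i)\in\mathcal{E}(A(i))$. Let $S\subseteq\mathbb{R}_+^k$. Two points $x,y\in S$ are PWL (piecewise linearly) connected in $S$ if, for some $u_0,\ldots,u_s\in S$ with $u_0=x$ and $u_s=y$, we have $tu_i+(1-t)u_{i+1}\in S$ for all $i=0,\ldots,s-1$ and all $t\in(0,1)$. The set $S$ is PWL connected if any $x,y\in S$ are PWL connected in $S$. *)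

theory Defs
  imports Complex_Main "Jordan_Normal_Form.Determinant"
begin

text \<open>Indices run over \<open>{0..<n}\<close>, following the matrix library.\<close>

definition reciprocal_matrices :: "nat \<Rightarrow> real mat set" where
  "reciprocal_matrices n =
    {A \<in> carrier_mat n n. \<forall>i<n. \<forall>j<n. A $$ (i, j) > 0 \<and> A $$ (j, i) = 1 / A $$ (i, j)}"

definition positive_vectors :: "nat \<Rightarrow> real vec set" where
  "positive_vectors n = {w \<in> carrier_vec n. \<forall>i<n. w $ i > 0}"

definition proportional :: "real vec \<Rightarrow> real vec \<Rightarrow> bool" where
  "proportional v w \<longleftrightarrow> (\<exists>c. v = c \<cdot>\<^sub>v w)"

definition efficient :: "real mat \<Rightarrow> real vec \<Rightarrow> bool" where
  "efficient A w \<longleftrightarrow> (\<forall>v \<in> positive_vectors (dim_row A).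
    (\<forall>i<dim_row A. \<forall>j<dim_row A.
      \<bar>A $$ (i, j) - v $ i / v $ j\<bar> \<le> \<bar>A $$ (i, j) - w $ i / w $ j\<bar>) \<longrightarrow> proportional v w)"

definition efficient_vectors :: "real mat \<Rightarrow> real vec set" where
  "efficient_vectors A = {w \<in> positive_vectors (dim_row A). efficient A w}"

text \<open>The vector counterpart of \<^const>\<open>mat_delete\<close>.\<close>

definition vec_delete :: "'a vec \<Rightarrow> nat \<Rightarrow> 'a vec" where
  "vec_delete w i = vec (dim_vec w - 1) (\<lambda>k. w $ (if k < i then k else Suc k))"

definition efficient_vectors_at :: "real mat \<Rightarrow> nat \<Rightarrow> real vec set" where
  "efficient_vectors_at A i =
    {w \<in> efficient_vectors A. vec_delete w i \<in> efficient_vectors (mat_delete A i i)}"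

definition pwl_connected_points :: "real vec set \<Rightarrow> real vec \<Rightarrow> real vec \<Rightarrow> bool" where
  "pwl_connected_points S x y \<longleftrightarrow>
    (\<exists>(s::nat) (u :: nat \<Rightarrow> real vec). (\<forall>k\<le>s. u k \<in> S) \<and> u 0 = x \<and> u s = y \<and>
      (\<forall>k<s. \<forall>t\<in>{0<..<1}. t \<cdot>\<^sub>v u k + (1 - t) \<cdot>\<^sub>v u (Suc k) \<in> S))"

definition pwl_connected :: "real vec set \<Rightarrow> bool" where
  "pwl_connected S \<longleftrightarrow> (\<forall>x\<in>S. \<forall>y\<in>S. pwl_connected_points S x y)"

end

theory Submission
  imports Defs
begin

text \<open>
  For a positive vector \<open>w\<close>, draw an arc from \<open>p\<close> to \<open>q\<close> if \<open>w\<^sub>p \<ge> a\<^sub>p\<^sub>q w\<^sub>q\<close>. By reciprocity any two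
  vertices are joined by an arc in at least one direction. A vector is efficient exactly if its
  digraph is strongly connected (\<open>efficient_vectors_iff\<close>): an arc from \<open>p\<close> to \<open>q\<close> forbids
  a competitor to increase \<open>w\<^sub>p / w\<^sub>q\<close>, and around closed walks all these ratios are then frozen,
  whereas scaling up a set that no arc leaves gives a better vector.

  Write \<open>E V\<close> for the positive weights whose digraph on the index set \<open>V\<close> is strong. The claim is
  that \<open>E V \<inter> E (V - {i})\<close> is connected by polygonal paths. For fixed weights in \<open>E (V - {i})\<close> the
  admissible values of \<open>w\<^sub>i\<close> form an interval, and for any fixed \<open>j \<noteq> i\<close> it contains \<open>a\<^sub>i\<^sub>j w\<^sub>j\<close>. The
  map replacing \<open>w\<^sub>i\<close> by \<open>a\<^sub>i\<^sub>j w\<^sub>j\<close> is linear, so it lifts segments in \<open>E (V - {i})\<close> to segments in the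
  intersection: the intersection is connected as soon as \<open>E (V - {i})\<close> is
  (\<open>pwl_joined_strong_weights_at\<close>).

  It remains to see that every \<open>E V\<close> is connected (\<open>pwl_joined_strong_weights\<close>). This is an
  induction on \<open>V\<close>. Fix \<open>k \<in> V\<close>. Column \<open>k\<close> of the matrix lies in \<open>E V \<inter> E (V - {i})\<close> for every
  \<open>i \<noteq> k\<close>, and these sets are connected by induction, so it is enough to join each \<open>w \<in> E V\<close> to
  one of them inside \<open>E V\<close>. If no vertex other than \<open>k\<close> can be deleted from the digraph of \<open>w\<close>, a
  maximal strong proper vertex set \<open>S\<close> containing \<open>k\<close> misses exactly two vertices \<open>u\<close>, \<open>v\<close>, on a
  path from \<open>S\<close> through \<open>u\<close> and \<open>v\<close> back to \<open>S\<close> (\<open>strong_on_ear\<close>). Lowering \<open>w\<^sub>v\<close> until it ties with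
  \<open>k\<close> keeps this path and finally makes \<open>u\<close> deletable.
\<close>

section \<open>Strong digraphs\<close>

text \<open>
  Strong connectedness by cuts rather than by walks: every proper nonempty vertex set has a leaving
  arc. Efficiency fails exactly at a set without leaving arcs, so this form matches it directly.
\<close>

definition strong_on :: "'a set \<Rightarrow> ('a \<Rightarrow> 'a \<Rightarrow> bool) \<Rightarrow> bool" where
  "strong_on V E \<longleftrightarrow> (\<forall>T. T \<subseteq> V \<and> T \<noteq> {} \<and> T \<noteq> V \<longrightarrow> (\<exists>p\<in>T. \<exists>q\<in>V - T. E p q))"

lemma strong_on_cut:
  assumes "strong_on V E" "T \<subseteq> V" "T \<noteq> {}" "T \<noteq> V"
  shows "\<exists>p\<in>T. \<exists>q\<in>V - T. E p q"
  using assms unfolding strong_on_def by simp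

lemma strong_on_singleton: "strong_on {k} E"
  unfolding strong_on_def by blast

lemma strong_on_cong:
  assumes "strong_on V E" "\<And>p q. p \<in> V \<Longrightarrow> q \<in> V \<Longrightarrow> E p q \<Longrightarrow> E' p q"
  shows "strong_on V E'"
  using assms unfolding strong_on_def by (meson DiffD1 subsetD)

lemma strong_on_image:
  assumes "inj_on f U"
  shows "strong_on (f ` U) E \<longleftrightarrow> strong_on U (\<lambda>p q. E (f p) (f q))"
proof
  assume L: "strong_on (f ` U) E"
  show "strong_on U (\<lambda>p q. E (f p) (f q))"
    unfolding strong_on_def
  proof (intro allI impI, elim conjE)
    fix T assume T: "T \<subseteq> U" "T \<noteq> {}" "T \<noteq> U"
    have "f ` T \<noteq> f ` U" using T assms by (simp add: inj_on_image_eq_iff)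
    then have "\<exists>p\<in>f ` T. \<exists>q\<in>f ` U - f ` T. E p q"
      using strong_on_cut[OF L, of "f ` T"] T by (simp add: image_mono)
    then show "\<exists>p\<in>T. \<exists>q\<in>U - T. E (f p) (f q)" by blast
  qed
next
  assume R: "strong_on U (\<lambda>p q. E (f p) (f q))"
  show "strong_on (f ` U) E"
    unfolding strong_on_def
  proof (intro allI impI, elim conjE)
    fix T assume T: "T \<subseteq> f ` U" "T \<noteq> {}" "T \<noteq> f ` U"
    let ?T = "{p \<in> U. f p \<in> T}"
    have "?T \<subseteq> U" "?T \<noteq> {}" "?T \<noteq> U" using T by blast+
    then have "\<exists>p\<in>?T. \<exists>q\<in>U - ?T. E (f p) (f q)"
      by (rule strong_on_cut[OF R])
    then show "\<exists>p\<in>T. \<exists>q\<in>f ` U - T. E p q" by blast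
  qed
qed

lemma strong_on_insert:
  assumes S: "strong_on S E" and "p \<in> S" "E v p" "q \<in> S" "E q v"
  shows "strong_on (insert v S) E"
proof (cases "v \<in> S")
  case True then show ?thesis using S by (simp add: insert_absorb)
next
  case False
  show ?thesis unfolding strong_on_def
  proof (intro allI impI, elim conjE)
    fix T assume T: "T \<subseteq> insert v S" "T \<noteq> {}" "T \<noteq> insert v S"
    \<comment> \<open>A cut that does not split \<open>S\<close> separates \<open>v\<close> from \<open>S\<close>.\<close>
    consider "T = {v}" | "T = S" | "T \<inter> S \<noteq> {}" "T \<inter> S \<noteq> S" using T False by blast
    then show "\<exists>p\<in>T. \<exists>q\<in>insert v S - T. E p q"
    proof cases
      case 1 with assms False show ?thesis by blast
    next
      case 2 with assms False show ?thesis by blast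
    next
      case 3
      then have "\<exists>x\<in>T \<inter> S. \<exists>y\<in>S - T \<inter> S. E x y"
        by (intro strong_on_cut[OF S]) auto
      then show ?thesis by blast
    qed
  qed
qed

text \<open>
  Attaching an ear, that is a path from \<open>S\<close> through two further vertices back to \<open>S\<close>, preserves
  strength: a cut that does not split \<open>S\<close> is crossed by the ear.
\<close>

lemma strong_on_insert_ear:
  assumes S: "strong_on S E" and "q \<in> S" "E q u" "E u v" "p \<in> S" "E v p"
  shows "strong_on (insert u (insert v S)) E"
proof (cases "u \<in> S \<or> v \<in> S")
  case True
  then show ?thesis
  proof
    assume "u \<in> S"
    moreover from this have "strong_on (insert v S) E" using strong_on_insert[OF S] assms by blast
    ultimately show ?thesis by (simp add: insert_absorb)
  next
    assume "v \<in> S"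
    moreover from this have "strong_on (insert u S) E" using strong_on_insert[OF S] assms by blast
    ultimately show ?thesis by (simp add: insert_absorb)
  qed
next
  case False
  show ?thesis unfolding strong_on_def
  proof (intro allI impI, elim conjE)
    fix T assume T: "T \<subseteq> insert u (insert v S)" "T \<noteq> {}" "T \<noteq> insert u (insert v S)"
    consider "T \<inter> S = {}" | "T \<inter> S = S" | "T \<inter> S \<noteq> {}" "T \<inter> S \<noteq> S" by blast
    then show "\<exists>p\<in>T. \<exists>q\<in>insert u (insert v S) - T. E p q"
    proof cases
      case 1
      show ?thesis
      proof (cases "v \<in> T")
        case True with 1 assms False show ?thesis by blast
      next
        case v: False
        then have "u \<in> T" using T 1 by blast
        then show ?thesis using v assms by blast
      qed
    next
      case 2
      show ?thesis
      proof (cases "u \<in> T")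
        case True
        then have "v \<notin> T" using T 2 by blast
        then show ?thesis using True assms by blast
      next
        case u: False
        then show ?thesis using 2 assms by blast
      qed
    next
      case 3
      then have "\<exists>x\<in>T \<inter> S. \<exists>y\<in>S - T \<inter> S. E x y"
        by (intro strong_on_cut[OF S]) auto
      then show ?thesis by blast
    qed
  qed
qed

text \<open>
  The structure of a strong semicomplete digraph in which only \<open>k\<close> may be deletable. Take \<open>S\<close>
  maximal among the strong proper vertex sets containing \<open>k\<close>. An outside vertex with arcs both to
  and from \<open>S\<close> could be added to \<open>S\<close>, so each outside vertex has arcs in one direction only. Some
  vertex \<open>u\<close> that \<open>S\<close> points to then has an arc to some vertex \<open>v\<close> that points to \<open>S\<close>, and this
  ear exhausts the vertices by maximality.
\<close>

lemma strong_on_ear: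
  assumes fin: "finite V" and strong: "strong_on V E"
    and semi: "\<forall>p\<in>V. \<forall>q\<in>V. E p q \<or> E q p"
    and k: "k \<in> V" "V \<noteq> {k}"
    and essential: "\<not> (\<exists>i\<in>V. i \<noteq> k \<and> strong_on (V - {i}) E)"
  obtains u v S q where "V = insert u (insert v S)" "u \<notin> S" "v \<notin> S" "u \<noteq> v" "k \<in> S"
      "strong_on S E" "q \<in> S" "E q u" "E u v" "E v k"
proof -
  let ?C = "{S. S \<subset> V \<and> k \<in> S \<and> strong_on S E}"
  have "finite ?C" using fin by (auto intro: finite_subset[of _ "Pow V"])
  moreover have "{k} \<in> ?C" using k strong_on_singleton by auto
  ultimately have "\<exists>S\<in>?C. {k} \<subseteq> S \<and> (\<forall>R\<in>?C. S \<subseteq> R \<longrightarrow> S = R)"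
    by (rule finite_has_maximal2)
  then obtain S where SC: "S \<in> ?C" and max': "\<forall>R\<in>?C. S \<subseteq> R \<longrightarrow> S = R" by (elim bexE conjE)
  have max: "R = S" if "R \<in> ?C" "S \<subseteq> R" for R
    using bspec[OF max' that(1)] that(2) by (rule mp[THEN sym])
  from SC have SV: "S \<subset> V" and kS: "k \<in> S" and S: "strong_on S E" by blast+
  \<comment> \<open>Adding a single vertex to \<open>S\<close> does not reach \<open>V\<close>, as that vertex would be deletable.\<close>
  have far: "V \<noteq> insert i S" for i
  proof
    assume i: "V = insert i S"
    then have "i \<notin> S" using SV by auto
    then have "V - {i} = S" "i \<noteq> k" using i kS by auto
    then show False using essential i S by simp
  qed
  have one_sided: "\<not> (E v p \<and> E q v)" if "v \<in> V - S" "p \<in> S" "q \<in> S" for v p q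
  proof
    assume "E v p \<and> E q v"
    then have "strong_on (insert v S) E" using strong_on_insert[OF S] that by blast
    moreover have "insert v S \<subset> V" using far[of v] SV that by blast
    ultimately have "insert v S = S" using max[of "insert v S"] kS by blast
    then show False using that by blast
  qed
  let ?Out = "{v \<in> V - S. \<exists>q\<in>S. E q v}"
  have "\<exists>v\<in>V - S. \<exists>s\<in>V - (V - S). E v s"
    by (rule strong_on_cut[OF strong]) (use SV kS k in auto)
  then obtain v1 s1 where "v1 \<in> V - S" "s1 \<in> S" "E v1 s1" by blast
  then have "v1 \<notin> ?Out" using one_sided by blast
  then have "S \<union> ?Out \<noteq> V" using \<open>v1 \<in> V - S\<close> by blast
  then have "\<exists>u\<in>S \<union> ?Out. \<exists>v\<in>V - (S \<union> ?Out). E u v"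
    by (intro strong_on_cut[OF strong]) (use SV kS in auto)
  then obtain u v where uv: "u \<in> S \<union> ?Out" "v \<in> V - (S \<union> ?Out)" "E u v" by blast
  then have u: "u \<in> ?Out" by blast
  then obtain q where q: "q \<in> S" "E q u" by blast
  \<comment> \<open>No arc from \<open>S\<close> reaches \<open>v\<close>, so by semicompleteness the arc between \<open>v\<close> and \<open>k\<close> leaves \<open>v\<close>.\<close>
  have "E v k" using uv semi k kS by blast
  let ?R = "insert u (insert v S)"
  have R: "strong_on ?R E" using strong_on_insert_ear[OF S q \<open>E u v\<close> kS \<open>E v k\<close>] .
  have "?R = V"
  proof (rule ccontr)
    assume "?R \<noteq> V"
    then have "?R \<in> ?C" using R uv u SV kS by blast
    then have "?R = S" using max by blast
    then show False using u by blast
  qed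
  then show thesis using that[of u v S q] u uv q kS S \<open>E v k\<close> by blast
qed

section \<open>Weights with a strong digraph\<close>

definition reciprocal_on :: "'a set \<Rightarrow> ('a \<Rightarrow> 'a \<Rightarrow> real) \<Rightarrow> bool" where
  "reciprocal_on V a \<longleftrightarrow> (\<forall>p\<in>V. \<forall>q\<in>V. 0 < a p q \<and> a p q * a q p = 1)"

definition dominates :: "('a \<Rightarrow> 'a \<Rightarrow> real) \<Rightarrow> ('a \<Rightarrow> real) \<Rightarrow> 'a \<Rightarrow> 'a \<Rightarrow> bool" where
  "dominates a w p q \<longleftrightarrow> a p q * w q \<le> w p"

text \<open>
  Values outside \<open>V\<close> are left free. The same function can thus be a weight for \<open>V\<close> and for
  \<open>V - {i}\<close>, and deleting an index becomes an intersection of sets.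
\<close>

definition strong_weights :: "('a \<Rightarrow> 'a \<Rightarrow> real) \<Rightarrow> 'a set \<Rightarrow> ('a \<Rightarrow> real) set" where
  "strong_weights a V = {w. (\<forall>p\<in>V. 0 < w p) \<and> strong_on V (dominates a w)}"

lemma reciprocal_on_subset: "reciprocal_on V a \<Longrightarrow> U \<subseteq> V \<Longrightarrow> reciprocal_on U a"
  unfolding reciprocal_on_def by blast

lemma reciprocal_on_flip:
  assumes "reciprocal_on V a" "p \<in> V" "q \<in> V"
  shows "a p q * x \<le> y \<longleftrightarrow> x \<le> a q p * y"
proof -
  have pos: "0 < a q p" and one: "a q p * a p q = 1"
    using assms unfolding reciprocal_on_def by blast+
  have "a p q * x \<le> y \<longleftrightarrow> a q p * (a p q * x) \<le> a q p * y" using pos by simp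
  also have "a q p * (a p q * x) = x" using one by (simp flip: mult.assoc)
  finally show ?thesis .
qed

lemma dominates_flip:
  assumes "reciprocal_on V a" "p \<in> V" "q \<in> V"
  shows "dominates a w p q \<longleftrightarrow> w q \<le> a q p * w p"
  unfolding dominates_def by (rule reciprocal_on_flip[OF assms])

text \<open>
  A column of the matrix ties index \<open>k\<close> with every other index, so its digraph contains a star with
  arcs in both directions. It serves as a common point of the sets to be connected.
\<close>

lemma column_strong_weight:
  assumes r: "reciprocal_on V a" and k: "k \<in> V"
  shows "(\<lambda>p. a p k) \<in> strong_weights a V"
proof -
  let ?D = "dominates a (\<lambda>p. a p k)"
  have "a k k * a k k = 1" "0 < a k k" using r k unfolding reciprocal_on_def by blast+
  then have "a k k = 1" using power2_eq_1_iff[of "a k k"] by (auto simp: power2_eq_square)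
  then have D: "?D p k \<and> ?D k p" if "p \<in> V" for p
    using r k that unfolding reciprocal_on_def dominates_def by simp
  have "strong_on V ?D" unfolding strong_on_def
  proof (intro allI impI, elim conjE)
    fix T assume "T \<subseteq> V" "T \<noteq> {}" "T \<noteq> V"
    then show "\<exists>p\<in>T. \<exists>q\<in>V - T. ?D p q"
      using D k by (cases "k \<in> T") blast+
  qed
  then show ?thesis using r k unfolding strong_weights_def reciprocal_on_def by blast
qed

section \<open>Piecewise linear connectedness\<close>

text \<open>The closed parameter range makes both end points members of \<open>S\<close>.\<close>

definition segment_in :: "('a \<Rightarrow> real) set \<Rightarrow> ('a \<Rightarrow> real) \<Rightarrow> ('a \<Rightarrow> real) \<Rightarrow> bool" where
  "segment_in S x y \<longleftrightarrow> (\<forall>t\<in>{0..1}. (\<lambda>p. t * x p + (1 - t) * y p) \<in> S)"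

definition pwl_joined :: "('a \<Rightarrow> real) set \<Rightarrow> bool" where
  "pwl_joined S \<longleftrightarrow> (\<forall>x\<in>S. \<forall>y\<in>S. (segment_in S)\<^sup>*\<^sup>* x y)"

lemma segment_in_mono: "segment_in S x y \<Longrightarrow> S \<subseteq> T \<Longrightarrow> segment_in T x y"
  unfolding segment_in_def by blast

lemma segment_in_sym: "segment_in S x y \<Longrightarrow> segment_in S y x"
  unfolding segment_in_def
proof
  fix t :: real assume *: "\<forall>t\<in>{0..1}. (\<lambda>p. t * x p + (1 - t) * y p) \<in> S" and "t \<in> {0..1}"
  then have "(\<lambda>p. (1 - t) * x p + (1 - (1 - t)) * y p) \<in> S" using bspec[OF *, of "1 - t"] by simp
  then show "(\<lambda>p. t * y p + (1 - t) * x p) \<in> S" by (simp add: add.commute)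
qed

lemma segment_path_sym: "(segment_in S)\<^sup>*\<^sup>* x y \<Longrightarrow> (segment_in S)\<^sup>*\<^sup>* y x"
proof (induction rule: rtranclp_induct)
  case (step y z)
  from segment_in_sym[OF step.hyps(2)] step.IH show ?case
    by (rule converse_rtranclp_into_rtranclp[where r = "segment_in S"])
qed simp

lemma segment_path_mono:
  assumes "(segment_in S)\<^sup>*\<^sup>* x y" "S \<subseteq> T"
  shows "(segment_in T)\<^sup>*\<^sup>* x y"
  using assms(1)
proof (induction rule: rtranclp_induct)
  case (step y z)
  from step.IH segment_in_mono[OF step.hyps(2) assms(2)] show ?case
    by (rule rtranclp.rtrancl_into_rtrancl[where r = "segment_in T"])
qed simp

lemma segment_in_update:
  assumes "\<And>c. min (w i) d \<le> c \<Longrightarrow> c \<le> max (w i) d \<Longrightarrow> w(i := c) \<in> S"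
  shows "segment_in S w (w(i := d))"
  unfolding segment_in_def
proof
  fix t :: real assume t: "t \<in> {0..1}"
  let ?c = "t * w i + (1 - t) * d"
  have "min (w i) d = t * min (w i) d + (1 - t) * min (w i) d" by (simp add: algebra_simps)
  also have "\<dots> \<le> ?c" using t by (intro add_mono mult_left_mono) auto
  finally have lo: "min (w i) d \<le> ?c" .
  have "?c \<le> t * max (w i) d + (1 - t) * max (w i) d" using t by (intro add_mono mult_left_mono) auto
  also have "\<dots> = max (w i) d" by (simp add: algebra_simps)
  finally have "w(i := ?c) \<in> S" using assms lo by blast
  moreover have "(\<lambda>p. t * w p + (1 - t) * (w(i := d)) p) = w(i := ?c)"
    by (auto simp: algebra_simps)
  ultimately show "(\<lambda>p. t * w p + (1 - t) * (w(i := d)) p) \<in> S" by simp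
qed

section \<open>Connectedness of strong weights\<close>

lemma strong_weights_update_outside:
  assumes "w \<in> strong_weights a U" "i \<notin> U"
  shows "w(i := c) \<in> strong_weights a U"
proof -
  have "strong_on U (dominates a (w(i := c)))"
    using assms unfolding strong_weights_def
    by (auto elim!: strong_on_cong simp: dominates_def)
  then show ?thesis using assms unfolding strong_weights_def by auto
qed

lemma strong_weights_add_index:
  assumes w: "w \<in> strong_weights a (V - {i})" and i: "i \<in> V" and pos: "0 < w i"
    and "p \<in> V - {i}" "dominates a w i p" "q \<in> V - {i}" "dominates a w q i"
  shows "w \<in> strong_weights a V"
proof -
  have "strong_on (insert i (V - {i})) (dominates a w)"
    using assms strong_on_insert[of "V - {i}" "dominates a w" p i q]
    unfolding strong_weights_def by blast
  then show ?thesis using w i pos unfolding strong_weights_def by (auto simp: insert_absorb)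
qed

text \<open>
  Over a weight in \<open>E (V - {i})\<close>, membership in \<open>E V\<close> only asks index \<open>i\<close> for one arc out and one
  arc in. Setting \<open>w i\<close> to \<open>a i j * w j\<close> ties \<open>i\<close> with \<open>j\<close> and provides both. A path between two
  points moves to this section along coordinate \<open>i\<close>, follows the lift of a path in \<open>E (V - {i})\<close>,
  and returns along coordinate \<open>i\<close>. One fixed \<open>j\<close> is used throughout because the section has to be
  linear, which the extreme admissible values of \<open>w i\<close> are not.
\<close>

lemma pwl_joined_strong_weights_at:
  assumes r: "reciprocal_on V a" and i: "i \<in> V" and V: "V \<noteq> {i}"
    and joined: "pwl_joined (strong_weights a (V - {i}))"
  shows "pwl_joined (strong_weights a V \<inter> strong_weights a (V - {i}))"
proof -
  let ?U = "V - {i}"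
  let ?F = "strong_weights a V \<inter> strong_weights a ?U"
  obtain j where j: "j \<in> ?U" using i V by blast
  have aij: "0 < a i j" using r i j unfolding reciprocal_on_def by blast
  define lift where "lift w = w(i := a i j * w j)" for w
  have into: "w(i := c) \<in> ?F"
    if w: "w \<in> strong_weights a ?U" and "0 < c"
      and p: "p \<in> ?U" "a i p * w p \<le> c" and q: "q \<in> ?U" "a q i * c \<le> w q" for w c p q
  proof -
    have U: "w(i := c) \<in> strong_weights a ?U" using strong_weights_update_outside[OF w] by simp
    moreover have "w(i := c) \<in> strong_weights a V"
      using strong_weights_add_index[OF U i, of p q] \<open>0 < c\<close> p q unfolding dominates_def by simp
    ultimately show ?thesis by blast
  qed
  have lift: "lift w \<in> ?F" if w: "w \<in> strong_weights a ?U" for w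
  proof -
    have "0 < w j" using w j unfolding strong_weights_def by blast
    moreover have "a j i * (a i j * w j) \<le> w j"
      using reciprocal_on_flip[OF r, of j i] i j by simp
    ultimately show ?thesis unfolding lift_def using into[OF w _ j _ j] aij by simp
  qed
  have vertical: "segment_in ?F w (lift w)" if w: "w \<in> ?F" for w
    unfolding lift_def
  proof (rule segment_in_update)
    fix c assume c: "min (w i) (a i j * w j) \<le> c" "c \<le> max (w i) (a i j * w j)"
    have pos: "\<forall>p\<in>V. 0 < w p" and st: "strong_on V (dominates a w)" and wU: "w \<in> strong_weights a ?U"
      using w unfolding strong_weights_def by blast+
    have "\<exists>p\<in>{i}. \<exists>q\<in>V - {i}. dominates a w p q"
      by (rule strong_on_cut[OF st]) (use i V in auto)
    then obtain p where p: "p \<in> ?U" "a i p * w p \<le> w i" unfolding dominates_def by blast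
    have "\<exists>p\<in>?U. \<exists>q\<in>V - ?U. dominates a w p q"
      by (rule strong_on_cut[OF st]) (use i j in auto)
    then obtain q where q: "q \<in> ?U" "a q i * w i \<le> w q" unfolding dominates_def by blast
    have "0 < min (w i) (a i j * w j)" using pos i j aij by simp
    then have "0 < c" using c by linarith
    \<comment> \<open>Below \<open>w i\<close> the arc from \<open>q\<close> survives, above it the arc to \<open>p\<close>; when the other old arc is
      lost, \<open>c\<close> lies on the side of the tie value where \<open>j\<close> supplies the missing arc.\<close>
    show "w(i := c) \<in> ?F"
    proof (cases "c \<le> w i")
      case True
      have "0 < a q i" using r i q unfolding reciprocal_on_def by blast
      then have "a q i * c \<le> w q" using q True by (meson mult_left_mono less_imp_le order_trans)
      moreover have "\<exists>p\<in>?U. a i p * w p \<le> c"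
      proof (cases "w i \<le> a i j * w j")
        case False then show ?thesis using c j by auto
      next
        case w: True then show ?thesis using c p True by auto
      qed
      ultimately show ?thesis using into[OF wU \<open>0 < c\<close>] q by blast
    next
      case False
      then have "c \<le> a i j * w j" using c by auto
      then have "a j i * c \<le> w j" using reciprocal_on_flip[OF r, of j i] i j by simp
      then show ?thesis using into[OF wU \<open>0 < c\<close> p(1) _ j] p False by simp
    qed
  qed
  have segment_lift: "segment_in ?F (lift x) (lift y)" if xy: "segment_in (strong_weights a ?U) x y" for x y
    unfolding segment_in_def
  proof
    fix t :: real assume "t \<in> {0..1}"
    then have "lift (\<lambda>p. t * x p + (1 - t) * y p) \<in> ?F"
      using xy lift unfolding segment_in_def by blast
    moreover have "lift (\<lambda>p. t * x p + (1 - t) * y p) = (\<lambda>p. t * lift x p + (1 - t) * lift y p)"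
      by (auto simp: lift_def algebra_simps)
    ultimately show "(\<lambda>p. t * lift x p + (1 - t) * lift y p) \<in> ?F" by simp
  qed
  have path: "(segment_in ?F)\<^sup>*\<^sup>* (lift x) (lift y)"
    if "(segment_in (strong_weights a ?U))\<^sup>*\<^sup>* x y" for x y
    using that
  proof (induction rule: rtranclp_induct)
    case (step y z)
    from step.IH segment_lift[OF step.hyps(2)] show ?case
      by (rule rtranclp.rtrancl_into_rtrancl[where r = "segment_in ?F"])
  qed simp
  show ?thesis unfolding pwl_joined_def
  proof (intro ballI)
    fix x y assume x: "x \<in> ?F" and y: "y \<in> ?F"
    have "(segment_in ?F)\<^sup>*\<^sup>* x (lift x)" using vertical[OF x] by blast
    also have "(segment_in ?F)\<^sup>*\<^sup>* (lift x) (lift y)"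
      using path joined x y unfolding pwl_joined_def by blast
    also have "(segment_in ?F)\<^sup>*\<^sup>* (lift y) y" using segment_in_sym[OF vertical[OF y]] by blast
    finally show "(segment_in ?F)\<^sup>*\<^sup>* x y" .
  qed
qed

text \<open>
  In the ear case, lowering \<open>w v\<close> can only strengthen the arc from \<open>u\<close> to \<open>v\<close>, and the arc from
  \<open>v\<close> to \<open>k\<close> persists down to the tie \<open>a v k * w k\<close>. So the ear stays in place and the digraph
  strong. At the tie, \<open>v\<close> and \<open>k\<close> have arcs in both directions, so \<open>S\<close> with \<open>v\<close> is strong without
  \<open>u\<close>.
\<close>

lemma strong_weight_joined_to_deletable:
  assumes fin: "finite V" and r: "reciprocal_on V a" and k: "k \<in> V" "V \<noteq> {k}"
    and w: "w \<in> strong_weights a V"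
  obtains i w' where "i \<in> V" "i \<noteq> k" "w' \<in> strong_weights a V \<inter> strong_weights a (V - {i})"
    "(segment_in (strong_weights a V))\<^sup>*\<^sup>* w w'"
proof -
  have pos: "\<And>p. p \<in> V \<Longrightarrow> 0 < w p" and st: "strong_on V (dominates a w)"
    using w unfolding strong_weights_def by blast+
  have semi: "\<forall>p\<in>V. \<forall>q\<in>V. dominates a w p q \<or> dominates a w q p"
    using dominates_flip[OF r, of _ _ w] unfolding dominates_def by (meson linear)
  show thesis
  proof (cases "\<exists>i\<in>V. i \<noteq> k \<and> strong_on (V - {i}) (dominates a w)")
    case True
    then obtain i where i: "i \<in> V" "i \<noteq> k" "strong_on (V - {i}) (dominates a w)" by blast
    then have "w \<in> strong_weights a (V - {i})" using pos unfolding strong_weights_def by blast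
    then show thesis using that[of i w] i w by blast
  next
    case False
    then obtain u v S q where ear: "V = insert u (insert v S)" "u \<notin> S" "v \<notin> S" "u \<noteq> v" "k \<in> S"
        "strong_on S (dominates a w)" "q \<in> S" "dominates a w q u" "dominates a w u v" "dominates a w v k"
      by (rule strong_on_ear[OF fin st semi k])
    have S: "w \<in> strong_weights a S" using pos ear unfolding strong_weights_def by blast
    have inV: "u \<in> V" "v \<in> V" "k \<in> V" using ear by auto
    have apos: "0 < a u v" "0 < a v k" using r inV unfolding reciprocal_on_def by blast+
    have slide: "w(v := c) \<in> strong_weights a V" if c: "a v k * w k \<le> c" "c \<le> w v" for c
    proof -
      let ?D = "dominates a (w(v := c))"
      have "strong_on S ?D"
        using strong_weights_update_outside[OF S \<open>v \<notin> S\<close>] unfolding strong_weights_def by blast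
      moreover have "?D q u" "?D v k" using ear c by (auto simp: dominates_def)
      moreover have "?D u v"
      proof -
        have "a u v * c \<le> a u v * w v" using apos c by simp
        then show ?thesis using ear by (auto simp: dominates_def)
      qed
      ultimately have "strong_on V ?D"
        using strong_on_insert_ear[of S ?D q u v k] ear by blast
      moreover have "0 < a v k * w k" using apos pos inV by simp
      then have "0 < c" using c by linarith
      ultimately show ?thesis using pos unfolding strong_weights_def by auto
    qed
    let ?d = "a v k * w k"
    let ?w = "w(v := ?d)"
    have d: "?d \<le> w v" using ear by (simp add: dominates_def)
    have "segment_in (strong_weights a V) w ?w"
      by (rule segment_in_update) (use slide d in \<open>simp add: min_def max_def split: if_splits\<close>)
    moreover have "?w \<in> strong_weights a V" using slide d by blast
    moreover have "?w \<in> strong_weights a (V - {u})"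
    proof (rule strong_weights_add_index[where i = v and p = k and q = k])
      have "V - {u} - {v} = S" using ear by blast
      then show "?w \<in> strong_weights a (V - {u} - {v})"
        using strong_weights_update_outside[OF S \<open>v \<notin> S\<close>] by simp
      show "dominates a ?w k v"
        using ear reciprocal_on_flip[OF r, of k v] inV by (auto simp: dominates_def)
    qed (use ear pos inV apos in \<open>auto simp: dominates_def\<close>)
    ultimately show thesis using that[of u ?w] ear by blast
  qed
qed

text \<open>
  All weights are joined to column \<open>k\<close>. For this the deletable index \<open>i\<close> must differ from \<open>k\<close>,
  because the column need not be a strong weight with deletable index \<open>k\<close>.
\<close>

lemma pwl_joined_strong_weights:
  assumes "finite V" "V \<noteq> {}" "reciprocal_on V a"
  shows "pwl_joined (strong_weights a V)"
  using assms
proof (induction V rule: finite_psubset_induct)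
  case (psubset V)
  then obtain k where k: "k \<in> V" by blast
  show ?case
  proof (cases "V = {k}")
    case True
    have "segment_in (strong_weights a V) x y"
      if "x \<in> strong_weights a V" "y \<in> strong_weights a V" for x y
      unfolding segment_in_def
    proof
      fix t :: real assume t: "t \<in> {0..1}"
      have "0 < x k" "0 < y k" using that True by (auto simp: strong_weights_def)
      then have "0 < t * x k + (1 - t) * y k"
        using t by (cases "t = 0") (auto intro: add_pos_nonneg)
      then show "(\<lambda>p. t * x p + (1 - t) * y p) \<in> strong_weights a V"
        using True by (simp add: strong_weights_def strong_on_singleton)
    qed
    then show ?thesis unfolding pwl_joined_def by blast
  next
    case False
    let ?E = "strong_weights a V"
    let ?col = "\<lambda>p. a p k"
    have to_col: "(segment_in ?E)\<^sup>*\<^sup>* w ?col" if w: "w \<in> ?E" for w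
    proof -
      obtain i w' where i: "i \<in> V" "i \<noteq> k" and w': "w' \<in> ?E \<inter> strong_weights a (V - {i})"
        and ww': "(segment_in ?E)\<^sup>*\<^sup>* w w'"
        using strong_weight_joined_to_deletable[OF psubset.hyps(1) psubset.prems(2) k False w] by blast
      have sub: "V - {i} \<subset> V" and ne: "V - {i} \<noteq> {}" and kVi: "k \<in> V - {i}" and Vi: "V \<noteq> {i}"
        using i k by blast+
      have r: "reciprocal_on (V - {i}) a" using reciprocal_on_subset psubset.prems(2) by blast
      have "pwl_joined (?E \<inter> strong_weights a (V - {i}))"
        by (rule pwl_joined_strong_weights_at[OF psubset.prems(2) i(1) Vi psubset.IH[OF sub ne r]])
      moreover have "?col \<in> ?E \<inter> strong_weights a (V - {i})"
        using column_strong_weight[OF psubset.prems(2) k] column_strong_weight[OF r kVi] by simp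
      ultimately have "(segment_in (?E \<inter> strong_weights a (V - {i})))\<^sup>*\<^sup>* w' ?col"
        using w' unfolding pwl_joined_def by blast
      from this Int_lower1 have "(segment_in ?E)\<^sup>*\<^sup>* w' ?col" by (rule segment_path_mono)
      with ww' show ?thesis by (rule rtranclp_trans[where r = "segment_in ?E"])
    qed
    show ?thesis unfolding pwl_joined_def
    proof (intro ballI)
      fix x y assume "x \<in> ?E" "y \<in> ?E"
      from to_col[OF this(1)] segment_path_sym[OF to_col[OF this(2)]]
      show "(segment_in ?E)\<^sup>*\<^sup>* x y" by (rule rtranclp_trans[where r = "segment_in ?E"])
    qed
  qed
qed

section \<open>Efficiency of vectors as strong connectedness\<close>

text \<open>
  Along an arc from \<open>p\<close> to \<open>q\<close> the ratio \<open>w p / w q\<close> is at least the matrix entry, so a competitor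
  \<open>v\<close> at least as close cannot have a larger ratio; that is, \<open>v / w\<close> does not decrease along arcs. The
  set where \<open>v / w\<close> is maximal therefore has no leaving arc and is everything.
\<close>

lemma efficient_if_strong:
  assumes B: "dim_row B = m"
    and w: "w \<in> positive_vectors m"
    and st: "strong_on {..<m} (dominates (\<lambda>p q. B $$ (p, q)) (\<lambda>p. w $ p))"
  shows "efficient B w"
  unfolding efficient_def B
proof (intro ballI impI)
  fix v assume v: "v \<in> positive_vectors m"
    and close: "\<forall>i<m. \<forall>j<m. \<bar>B $$ (i, j) - v $ i / v $ j\<bar> \<le> \<bar>B $$ (i, j) - w $ i / w $ j\<bar>"
  have wpos: "\<And>p. p < m \<Longrightarrow> 0 < w $ p" and vpos: "\<And>p. p < m \<Longrightarrow> 0 < v $ p"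
    and dims: "dim_vec w = m" "dim_vec v = m"
    using v w by (auto simp: positive_vectors_def)
  let ?r = "\<lambda>p. v $ p / w $ p"
  have up: "?r p \<le> ?r q" if pq: "p < m" "q < m" and "B $$ (p, q) * w $ q \<le> w $ p" for p q
  proof -
    have "B $$ (p, q) \<le> w $ p / w $ q" using that wpos by (simp add: pos_le_divide_eq)
    then have "v $ p / v $ q \<le> w $ p / w $ q" using close pq by (smt (verit))
    then show ?thesis using wpos vpos pq by (simp add: field_simps)
  qed
  show "proportional v w"
  proof (cases "m = 0")
    case True
    then have "v = 0 \<cdot>\<^sub>v w" using dims by (intro eq_vecI) auto
    then show ?thesis unfolding proportional_def by blast
  next
    case False
    define M where "M = Max (?r ` {..<m})"
    have "M \<in> ?r ` {..<m}" unfolding M_def using False by (intro Max_in) auto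
    then obtain p0 where p0: "p0 < m" "?r p0 = M" by auto
    have M: "?r p \<le> M" if "p < m" for p unfolding M_def using that by (intro Max_ge) auto
    let ?T = "{p \<in> {..<m}. ?r p = M}"
    have "?T = {..<m}"
    proof (rule ccontr)
      assume "?T \<noteq> {..<m}"
      moreover have "?T \<noteq> {}" using p0 by blast
      ultimately have "\<exists>p\<in>?T. \<exists>q\<in>{..<m} - ?T. B $$ (p, q) * w $ q \<le> w $ p"
        by (intro strong_on_cut[OF st, unfolded dominates_def]) blast+
      then obtain p q where pq: "p < m" "?r p = M" "q < m" "?r q \<noteq> M" "B $$ (p, q) * w $ q \<le> w $ p"
        by blast
      then show False using up[OF pq(1,3,5)] M[OF pq(3)] by linarith
    qed
    then have eq: "?r p = M" if "p < m" for p using that by blast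
    have "v $ p = M * w $ p" if "p < m" for p
      using eq[OF that] wpos[OF that] by (simp add: field_simps)
    then have "v = M \<cdot>\<^sub>v w" using dims by (intro eq_vecI) auto
    then show ?thesis unfolding proportional_def by blast
  qed
qed

text \<open>
  If no arc leaves \<open>T\<close>, every ratio from \<open>T\<close> to its complement is below its matrix entry. Scaling
  \<open>w\<close> on \<open>T\<close> by the largest factor that keeps these ratios at most at their entries improves them,
  and by reciprocity also the inverse ratios, without changing the others.
\<close>

lemma strong_if_efficient:
  assumes r: "reciprocal_on {..<m} (\<lambda>p q. B $$ (p, q))" and B: "dim_row B = m"
    and w: "w \<in> positive_vectors m" and eff: "efficient B w"
  shows "strong_on {..<m} (dominates (\<lambda>p q. B $$ (p, q)) (\<lambda>p. w $ p))"
proof (rule ccontr)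
  assume "\<not> ?thesis"
  then obtain T where T: "T \<subseteq> {..<m}" "T \<noteq> {}" "T \<noteq> {..<m}"
    and cut: "\<And>p q. p \<in> T \<Longrightarrow> q \<in> {..<m} - T \<Longrightarrow> w $ p < B $$ (p, q) * w $ q"
    unfolding strong_on_def dominates_def by (auto simp: not_le)
  have wpos: "\<And>p. p < m \<Longrightarrow> 0 < w $ p" and dim: "dim_vec w = m"
    using w by (auto simp: positive_vectors_def)
  let ?P = "T \<times> ({..<m} - T)"
  let ?slack = "\<lambda>(p, q). B $$ (p, q) * w $ q / w $ p"
  define c where "c = Min (?slack ` ?P)"
  have fin: "finite (?slack ` ?P)" using T
    by (meson finite_imageI finite_SigmaI finite_Diff finite_lessThan finite_subset)
  have ne: "?slack ` ?P \<noteq> {}" using T by auto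
  have "1 < ?slack x" if "x \<in> ?P" for x
    using that cut T wpos by (auto simp: less_divide_eq)
  then have c1: "1 < c" unfolding c_def using Min_in[OF fin ne] by auto
  have cle: "c * w $ p \<le> B $$ (p, q) * w $ q" if "p \<in> T" "q \<in> {..<m} - T" for p q
  proof -
    have "c \<le> ?slack (p, q)" unfolding c_def using fin that by (intro Min_le) auto
    then show ?thesis using wpos[of p] that T by (auto simp: pos_le_divide_eq)
  qed
  define v where "v = vec m (\<lambda>p. if p \<in> T then c * w $ p else w $ p)"
  have v: "v \<in> positive_vectors m" using wpos c1 by (auto simp: positive_vectors_def v_def)
  have "\<bar>B $$ (i, j) - v $ i / v $ j\<bar> \<le> \<bar>B $$ (i, j) - w $ i / w $ j\<bar>" if ij: "i < m" "j < m" for i j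
  proof -
    have wi: "0 < w $ i" and wj: "0 < w $ j" using wpos ij by auto
    consider "i \<in> T \<longleftrightarrow> j \<in> T" | "i \<in> T" "j \<notin> T" | "i \<notin> T" "j \<in> T" by blast
    then show ?thesis
    proof cases
      case 1
      then have "v $ i / v $ j = w $ i / w $ j" using ij c1 by (auto simp: v_def)
      then show ?thesis by simp
    next
      case 2
      have "w $ i / w $ j \<le> c * w $ i / w $ j"
        using c1 wi wj by (simp add: divide_right_mono)
      moreover have "c * w $ i / w $ j \<le> B $$ (i, j)"
        using cle[of i j] 2 ij wj by (simp add: pos_divide_le_eq)
      moreover have "v $ i / v $ j = c * w $ i / w $ j" using 2 ij by (simp add: v_def)
      ultimately show ?thesis by linarith
    next
      case 3
      have "w $ i / (c * w $ j) \<le> w $ i / w $ j"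
        using c1 wi wj by (simp add: frac_le)
      moreover have "B $$ (i, j) \<le> w $ i / (c * w $ j)"
      proof -
        have "c * w $ j \<le> B $$ (j, i) * w $ i" using cle[of j i] 3 ij by simp
        then have "B $$ (i, j) * (c * w $ j) \<le> w $ i"
          using reciprocal_on_flip[OF r, of i j] ij by simp
        then show ?thesis using c1 wj by (simp add: pos_le_divide_eq)
      qed
      moreover have "v $ i / v $ j = w $ i / (c * w $ j)" using 3 ij by (simp add: v_def)
      ultimately show ?thesis by linarith
    qed
  qed
  then have "proportional v w" using eff v B unfolding efficient_def by blast
  then obtain d where d: "v = d \<cdot>\<^sub>v w" unfolding proportional_def by blast
  obtain p where p: "p \<in> T" "p < m" using T by blast
  obtain q where q: "q \<notin> T" "q < m" using T by blast
  have scaled: "v $ r = d * w $ r" if "r < m" for r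
    using that dim unfolding d by simp
  have "c * w $ p = d * w $ p" "w $ q = d * w $ q"
    using scaled[OF p(2)] scaled[OF q(2)] p q unfolding v_def by simp_all
  then show False using wpos[OF p(2)] wpos[OF q(2)] c1 by auto
qed

lemma efficient_vectors_iff:
  assumes "reciprocal_on {..<m} (\<lambda>p q. B $$ (p, q))" "dim_row B = m" "w \<in> carrier_vec m"
  shows "w \<in> efficient_vectors B \<longleftrightarrow> (\<lambda>p. w $ p) \<in> strong_weights (\<lambda>p q. B $$ (p, q)) {..<m}"
proof -
  have "w \<in> positive_vectors m \<longleftrightarrow> (\<forall>p\<in>{..<m}. 0 < w $ p)"
    using assms(3) by (auto simp: positive_vectors_def)
  then show ?thesis
    using efficient_if_strong[OF assms(2)] strong_if_efficient[OF assms(1,2)] assms(2)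
    unfolding efficient_vectors_def strong_weights_def by blast
qed

lemma reciprocal_on_matrix:
  assumes "A \<in> reciprocal_matrices n"
  shows "reciprocal_on {..<n} (\<lambda>p q. A $$ (p, q))"
  unfolding reciprocal_on_def
proof (intro ballI)
  fix p q assume "p \<in> {..<n}" "q \<in> {..<n}"
  then have "A $$ (p, q) > 0" "A $$ (q, p) = 1 / A $$ (p, q)"
    using assms unfolding reciprocal_matrices_def by blast+
  then show "0 < A $$ (p, q) \<and> A $$ (p, q) * A $$ (q, p) = 1"
    by (metis less_irrefl nonzero_eq_divide_eq mult.commute)
qed

text \<open>Strong weights do not depend on how the indices are named, which absorbs the shift of indices
  caused by deleting a row and column.\<close>

lemma strong_weights_image:
  assumes "inj_on f U"
  shows "w \<circ> f \<in> strong_weights (\<lambda>p q. a (f p) (f q)) U \<longleftrightarrow> w \<in> strong_weights a (f ` U)"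
  using strong_on_image[OF assms, of "dominates a w"]
  unfolding strong_weights_def by (simp add: dominates_def[abs_def])

lemma strong_weights_cong:
  assumes "\<And>p q. p \<in> V \<Longrightarrow> q \<in> V \<Longrightarrow> a p q = b p q" "\<And>p. p \<in> V \<Longrightarrow> w p = x p"
    and "w \<in> strong_weights a V"
  shows "x \<in> strong_weights b V"
proof -
  have "strong_on V (dominates b x)"
    using assms unfolding strong_weights_def by (auto elim!: strong_on_cong simp: dominates_def)
  then show ?thesis using assms unfolding strong_weights_def by auto
qed

lemma vec_delete_efficient_iff:
  assumes A: "A \<in> reciprocal_matrices n" and i: "i < n" and w: "w \<in> carrier_vec n"
  shows "vec_delete w i \<in> efficient_vectors (mat_delete A i i) \<longleftrightarrow>
    (\<lambda>p. w $ p) \<in> strong_weights (\<lambda>p q. A $$ (p, q)) ({..<n} - {i})"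
proof -
  let ?f = "insert_index i"
  let ?a = "\<lambda>p q. A $$ (p, q)"
  let ?b = "\<lambda>p q. mat_delete A i i $$ (p, q)"
  have carrier: "A \<in> carrier_mat n n" using A by (simp add: reciprocal_matrices_def)
  have inj: "inj_on ?f {..<n - 1}" by (auto simp: inj_on_def insert_index_def split: if_splits)
  have img: "?f ` {..<n - 1} = {..<n} - {i}"
  proof (intro equalityI subsetI)
    fix q assume q: "q \<in> {..<n} - {i}"
    show "q \<in> ?f ` {..<n - 1}"
    proof (cases "q < i")
      case True
      then have "q = ?f q" "q < n - 1" using i by auto
      then show ?thesis by blast
    next
      case False
      then have "q = ?f (q - 1)" "q - 1 < n - 1" using q by auto
      then show ?thesis by blast
    qed
  qed (use i in \<open>auto simp: insert_index_def split: if_splits\<close>)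
  have fin: "?f p \<in> {..<n}" if "p < n - 1" for p using that img by blast
  have b: "?b p q = ?a (?f p) (?f q)" if "p < n - 1" "q < n - 1" for p q
    using carrier that i by (auto simp: mat_delete_def insert_index_def)
  have x: "vec_delete w i $ p = w $ ?f p" if "p < n - 1" for p
    using w that by (auto simp: vec_delete_def insert_index_def)
  have "reciprocal_on {..<n - 1} ?b"
    using reciprocal_on_matrix[OF A] b fin unfolding reciprocal_on_def by simp
  then have "vec_delete w i \<in> efficient_vectors (mat_delete A i i) \<longleftrightarrow>
      (\<lambda>p. vec_delete w i $ p) \<in> strong_weights ?b {..<n - 1}"
    using carrier w by (intro efficient_vectors_iff) (auto simp: mat_delete_def vec_delete_def)
  also have "\<dots> \<longleftrightarrow> (\<lambda>p. w $ p) \<circ> ?f \<in> strong_weights (\<lambda>p q. ?a (?f p) (?f q)) {..<n - 1}"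
    using b x by (auto elim!: strong_weights_cong[rotated 2])
  also have "\<dots> \<longleftrightarrow> (\<lambda>p. w $ p) \<in> strong_weights ?a ({..<n} - {i})"
    using strong_weights_image[OF inj, of "\<lambda>p. w $ p" ?a] img by simp
  finally show ?thesis .
qed

lemma efficient_vectors_at_iff:
  assumes A: "A \<in> reciprocal_matrices n" and i: "i < n"
  shows "w \<in> efficient_vectors_at A i \<longleftrightarrow> w \<in> carrier_vec n \<and>
    (\<lambda>p. w $ p) \<in> strong_weights (\<lambda>p q. A $$ (p, q)) {..<n} \<inter>
      strong_weights (\<lambda>p q. A $$ (p, q)) ({..<n} - {i})"
proof (cases "w \<in> carrier_vec n")
  case True
  have "dim_row A = n" using A by (auto simp: reciprocal_matrices_def)
  then show ?thesis
    using True efficient_vectors_iff[OF reciprocal_on_matrix[OF A]] vec_delete_efficient_iff[OF A i]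
    unfolding efficient_vectors_at_def by simp
next
  case False
  then show ?thesis using A
    by (auto simp: efficient_vectors_at_def efficient_vectors_def positive_vectors_def
        reciprocal_matrices_def)
qed

theorem corollary21:
  fixes n :: nat and A :: "real mat" and i :: nat
  assumes "n \<ge> 2" and "A \<in> reciprocal_matrices n" and "i < n"
  shows "pwl_connected (efficient_vectors_at A i)"
proof -
  let ?a = "\<lambda>p q. A $$ (p, q)"
  let ?F = "strong_weights ?a {..<n} \<inter> strong_weights ?a ({..<n} - {i})"
  have r: "reciprocal_on {..<n} ?a" using reciprocal_on_matrix[OF assms(2)] .
  have "(if i = 0 then 1 else 0) \<in> {..<n} - {i}" using assms by auto
  then have ne: "{..<n} - {i} \<noteq> {}" by blast
  then have ni: "{..<n} \<noteq> {i}" by blast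
  have "pwl_joined (strong_weights ?a ({..<n} - {i}))"
    by (rule pwl_joined_strong_weights[OF _ ne reciprocal_on_subset[OF r]]) auto
  then have F: "pwl_joined ?F"
    using pwl_joined_strong_weights_at[OF r _ ni] assms(3) by simp
  \<comment> \<open>Truncation to \<open>n\<close> entries turns paths of weight functions into paths of vectors.\<close>
  have vecF: "vec n f \<in> efficient_vectors_at A i" if "f \<in> ?F" for f
    using that assms(2,3) by (auto simp: efficient_vectors_at_iff elim!: strong_weights_cong[rotated 2])
  show ?thesis unfolding pwl_connected_def
  proof (intro ballI)
    fix x y assume "x \<in> efficient_vectors_at A i" "y \<in> efficient_vectors_at A i"
    then have x: "x \<in> carrier_vec n" "(\<lambda>p. x $ p) \<in> ?F" and y: "y \<in> carrier_vec n" "(\<lambda>p. y $ p) \<in> ?F"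
      using efficient_vectors_at_iff[OF assms(2,3)] by blast+
    then have "(segment_in ?F)\<^sup>*\<^sup>* (\<lambda>p. x $ p) (\<lambda>p. y $ p)" using F unfolding pwl_joined_def by blast
    then obtain s where "(segment_in ?F ^^ s) (\<lambda>p. x $ p) (\<lambda>p. y $ p)"
      using rtranclp_imp_relpowp[where P = "segment_in ?F"] by blast
    then obtain g where g: "g 0 = (\<lambda>p. x $ p)" "g s = (\<lambda>p. y $ p)"
      and steps: "\<forall>k<s. segment_in ?F (g k) (g (Suc k))"
      unfolding relpowp_fun_conv[where P = "segment_in ?F"] by (elim exE conjE)
    have seg: "segment_in ?F (g k) (g (Suc k))" if "k < s" for k using steps that by simp
    have gF: "g k \<in> ?F" if "k \<le> s" for k
    proof (cases "k = s")
      case False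
      then have "segment_in ?F (g k) (g (Suc k))" using seg that by simp
      from bspec[OF this[unfolded segment_in_def], of 1] show ?thesis by simp
    qed (use g y in simp)
    let ?u = "\<lambda>k. vec n (g k)"
    have "t \<cdot>\<^sub>v ?u k + (1 - t) \<cdot>\<^sub>v ?u (Suc k) \<in> efficient_vectors_at A i"
      if "k < s" "t \<in> {0<..<1}" for k t
    proof -
      have "(\<lambda>p. t * g k p + (1 - t) * g (Suc k) p) \<in> ?F"
        using seg[OF that(1)] that(2) unfolding segment_in_def by auto
      moreover have "vec n (\<lambda>p. t * g k p + (1 - t) * g (Suc k) p) =
          t \<cdot>\<^sub>v ?u k + (1 - t) \<cdot>\<^sub>v ?u (Suc k)" by auto
      ultimately show ?thesis using vecF by metis
    qed
    moreover have "?u 0 = x" "?u s = y" using g x y by auto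
    ultimately show "pwl_connected_points (efficient_vectors_at A i) x y"
      unfolding pwl_connected_points_def using vecF gF by (intro exI[of _ s] exI[of _ ?u]) blast
  qed
qed

end
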